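(* Let $m\ge2$ be an integer and $K\ge1$ a real number. If $T\colon c_0\times\cdots\times c_0\to\mathbb{R}$ is a continuous $m$-linear form composed of at most $K^m$ monomials, then $$\left(\sum_{j_1,\ldots,j_m=1}^{\infty}|T(e_{j_1},\ldots,e_{j_m})|^{\frac{2m}{m+1}}\right)^{\frac{m+1}{2m}}\le\sqrt{K}\,\|T\|.$$ That is, restricted to $m$-linear forms with up to $K^m$ monomials, the optimal constant of the $m$-linear Bohnenblust--Hille inequality is bounded by $\sqrt K$.
   Context: $c_0$ is the real Banach space of real null sequences with the sup norm, $(e_j)$ its canonical basis, and $\|T\|$ is the usual sup norm over the product of closed unit balls. The $m$-linear Bohnenblust--Hille inequality (real scalars) asserts that there is a constant $B$ with $\left(\sum_{j_1,\ldots,j_m}|T(e_{j_1},\ldots,e_{j_m})|^{\frac{2m}{m+1}}\right)^{\frac{m+1}{2m}}\le B\|T\|$ for all continuous $m$-linear forms $T\colon c_0\times\cdots\times c_0\to\mathbb{R}$. The number of monomials of $T(x^{(1)},\ldots,x^{(m)})=\sum\alpha_{i_1,\ldots,i_m}x^{(1)}_{i_1}\cdots x^{(m)}_{i_m}$ is $\operatorname{card}\{(i_1,\ldots,i_m):\alpha_{i_1,\ldots,i_m}\neq0\}$. *)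

theory Defs
  imports "HOL-Analysis.Analysis"
begin

section \<open>The Banach space of real null sequences\<close>

text \<open>Sequences are indexed from 0, so the index \<open>j\<close> here is the index \<open>j + 1\<close> of the usual notation.\<close>

typedef c0 = "{x :: nat \<Rightarrow> real. x \<longlonglongrightarrow> 0}"
  morphisms c0_nth Abs_c0
  by (rule exI[of _ "\<lambda>_. 0"]) simp

setup_lifting type_definition_c0

lemma c0_nth_tendsto: "c0_nth x \<longlonglongrightarrow> 0"
  using c0_nth by simp

lemma c0_eqI: "(\<And>n. c0_nth x n = c0_nth y n) \<Longrightarrow> x = y"
  by (simp add: c0_nth_inject[symmetric] fun_eq_iff)

lemma c0_bdd_above: "bdd_above (range (\<lambda>n. \<bar>c0_nth x n\<bar>))"
proof -
  have "Bseq (c0_nth x)"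
    using c0_nth_tendsto convergentI convergent_imp_Bseq by blast
  then show ?thesis
    by (auto simp: Bseq_def bdd_above_def real_norm_def)
qed

instantiation c0 :: real_vector
begin

lift_definition zero_c0 :: c0 is "\<lambda>_. 0" by simp

lift_definition plus_c0 :: "c0 \<Rightarrow> c0 \<Rightarrow> c0" is "\<lambda>x y n. x n + y n"
  using tendsto_add_zero by blast

lift_definition minus_c0 :: "c0 \<Rightarrow> c0 \<Rightarrow> c0" is "\<lambda>x y n. x n - y n"
  using tendsto_diff by fastforce

lift_definition uminus_c0 :: "c0 \<Rightarrow> c0" is "\<lambda>x n. - x n"
  using tendsto_minus by fastforce

lift_definition scaleR_c0 :: "real \<Rightarrow> c0 \<Rightarrow> c0" is "\<lambda>r x n. r * x n"
  by (rule tendsto_mult_right_zero)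

instance
  by standard (transfer; simp add: fun_eq_iff algebra_simps)+

end

instantiation c0 :: real_normed_vector
begin

definition norm_c0 :: "c0 \<Rightarrow> real" where
  "norm_c0 x = (SUP n. \<bar>c0_nth x n\<bar>)"

definition dist_c0 :: "c0 \<Rightarrow> c0 \<Rightarrow> real" where
  "dist_c0 x y = norm (x - y)"

definition sgn_c0 :: "c0 \<Rightarrow> c0" where
  "sgn_c0 x = x /\<^sub>R norm x"

definition uniformity_c0 :: "(c0 \<times> c0) filter" where
  "uniformity_c0 = (INF e\<in>{0<..}. principal {(x, y). dist x y < e})"

definition open_c0 :: "c0 set \<Rightarrow> bool" where
  "open_c0 U = (\<forall>x\<in>U. \<forall>\<^sub>F (x', y) in uniformity. x' = x \<longrightarrow> y \<in> U)"

lemma c0_abs_nth_le_norm: "\<bar>c0_nth x n\<bar> \<le> norm x"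
  unfolding norm_c0_def by (rule cSUP_upper[OF UNIV_I c0_bdd_above])

lemma c0_norm_leI: "(\<And>n. \<bar>c0_nth x n\<bar> \<le> b) \<Longrightarrow> norm x \<le> b"
  unfolding norm_c0_def by (rule cSUP_least) auto

instance
proof
  fix a :: real and x y :: c0
  show "dist x y = norm (x - y)" by (rule dist_c0_def)
  show "sgn x = x /\<^sub>R norm x" by (rule sgn_c0_def)
  show "uniformity = (INF e\<in>{0<..}. principal {(x :: c0, y). dist x y < e})"
    by (rule uniformity_c0_def)
  show "open U = (\<forall>x\<in>U. \<forall>\<^sub>F (x', y) in uniformity. x' = x \<longrightarrow> y \<in> U)" for U :: "c0 set"
    by (rule open_c0_def)
  show "norm x = 0 \<longleftrightarrow> x = 0"
  proof
    assume "norm x = 0"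
    then have "c0_nth x n = 0" for n
      using c0_abs_nth_le_norm[of x n] by simp
    then show "x = 0"
      by (intro c0_eqI) (simp add: zero_c0.rep_eq)
  next
    assume "x = 0"
    then show "norm x = 0"
      by (simp add: norm_c0_def zero_c0.rep_eq)
  qed
  show "norm (x + y) \<le> norm x + norm y"
  proof (rule c0_norm_leI)
    fix n
    show "\<bar>c0_nth (x + y) n\<bar> \<le> norm x + norm y"
      using c0_abs_nth_le_norm[of x n] c0_abs_nth_le_norm[of y n]
      by (simp add: plus_c0.rep_eq)
  qed
  have le: "norm (c *\<^sub>R u) \<le> \<bar>c\<bar> * norm u" for c and u :: c0
    by (rule c0_norm_leI)
       (simp add: scaleR_c0.rep_eq abs_mult mult_left_mono c0_abs_nth_le_norm)
  show "norm (a *\<^sub>R x) = \<bar>a\<bar> * norm x"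
  proof (cases "a = 0")
    case True
    have "a *\<^sub>R x = 0"
      using True by (intro c0_eqI) (simp add: zero_c0.rep_eq scaleR_c0.rep_eq)
    then show ?thesis
      using True by (simp add: norm_c0_def zero_c0.rep_eq)
  next
    case False
    have "x = inverse a *\<^sub>R (a *\<^sub>R x)"
      using False by (intro c0_eqI) (simp add: scaleR_c0.rep_eq)
    then have "norm x \<le> \<bar>inverse a\<bar> * norm (a *\<^sub>R x)"
      using le[of "inverse a" "a *\<^sub>R x"] by simp
    then have "\<bar>a\<bar> * norm x \<le> norm (a *\<^sub>R x)"
      using False by (simp add: field_simps)
    then show ?thesis
      using le[of a x] by simp
  qed
qed

end

instance c0 :: banach
proof
  fix X :: "nat \<Rightarrow> c0"
  assume X: "Cauchy X"
  have nth_diff: "\<bar>c0_nth x n - c0_nth y n\<bar> \<le> dist x y" for x y :: c0 and n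
    using c0_abs_nth_le_norm[of "x - y" n] by (simp add: dist_norm minus_c0.rep_eq)
  have "Cauchy (\<lambda>k. c0_nth (X k) n)" for n
  proof (rule metric_CauchyI)
    fix e :: real
    assume "0 < e"
    then obtain M where "\<forall>k\<ge>M. \<forall>l\<ge>M. dist (X k) (X l) < e"
      using X by (meson metric_CauchyD)
    then show "\<exists>M. \<forall>k\<ge>M. \<forall>l\<ge>M. dist (c0_nth (X k) n) (c0_nth (X l) n) < e"
      using nth_diff by (metis dist_real_def order_le_less_trans)
  qed
  then have "\<exists>l. (\<lambda>k. c0_nth (X k) n) \<longlonglongrightarrow> l" for n
    using Cauchy_convergent convergent_def by blast
  then obtain L where L: "\<And>n. (\<lambda>k. c0_nth (X k) n) \<longlonglongrightarrow> L n"
    by metis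
  have unif: "\<exists>M. \<forall>k\<ge>M. \<forall>n. \<bar>c0_nth (X k) n - L n\<bar> \<le> e" if e: "0 < e" for e :: real
  proof -
    obtain M where M: "\<forall>k\<ge>M. \<forall>l\<ge>M. dist (X k) (X l) < e"
      using X e by (meson metric_CauchyD)
    have "\<bar>c0_nth (X k) n - L n\<bar> \<le> e" if "k \<ge> M" for k n
    proof (rule tendsto_upperbound)
      show "(\<lambda>l. \<bar>c0_nth (X k) n - c0_nth (X l) n\<bar>) \<longlonglongrightarrow> \<bar>c0_nth (X k) n - L n\<bar>"
        by (intro tendsto_intros L)
      show "\<forall>\<^sub>F l in sequentially. \<bar>c0_nth (X k) n - c0_nth (X l) n\<bar> \<le> e"
        using M that nth_diff by (intro eventually_sequentiallyI[of M]) (meson less_imp_le order_trans)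
    qed simp
    then show ?thesis by blast
  qed
  have "L \<longlonglongrightarrow> 0"
  proof (rule LIMSEQ_I)
    fix r :: real
    assume r: "0 < r"
    then obtain k where k: "\<And>n. \<bar>c0_nth (X k) n - L n\<bar> \<le> r / 2"
      using unif[of "r / 2"] by auto
    obtain N where N: "\<forall>n\<ge>N. norm (c0_nth (X k) n - 0) < r / 2"
      using LIMSEQ_D[OF c0_nth_tendsto, of "r / 2" "X k"] r by auto
    have "norm (L n - 0) < r" if "n \<ge> N" for n
      using N[rule_format, OF that] k[of n] by (simp add: abs_if split: if_splits)
    then show "\<exists>N. \<forall>n\<ge>N. norm (L n - 0) < r" by blast
  qed
  then have nthL: "c0_nth (Abs_c0 L) = L"
    by (simp add: Abs_c0_inverse)
  have "X \<longlonglongrightarrow> Abs_c0 L"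
  proof (rule LIMSEQ_I)
    fix r :: real
    assume r: "0 < r"
    then obtain M where M: "\<forall>k\<ge>M. \<forall>n. \<bar>c0_nth (X k) n - L n\<bar> \<le> r / 2"
      using unif[of "r / 2"] by auto
    have "norm (X k - Abs_c0 L) < r" if "k \<ge> M" for k
    proof -
      have "norm (X k - Abs_c0 L) \<le> r / 2"
        using M that by (intro c0_norm_leI) (simp add: minus_c0.rep_eq nthL)
      then show ?thesis using r by simp
    qed
    then show "\<exists>M. \<forall>k\<ge>M. norm (X k - Abs_c0 L) < r" by blast
  qed
  then show "convergent X"
    by (rule convergentI)
qed

lift_definition c0_basis :: "nat \<Rightarrow> c0" is "\<lambda>j n. if n = j then 1 else 0 :: real"
proof -
  fix j
  show "(\<lambda>n. if n = j then 1 else 0 :: real) \<longlonglongrightarrow> 0"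
    by (rule tendsto_eventually, rule eventually_sequentiallyI[of "Suc j"]) auto
qed


section \<open>Multilinear forms\<close>

text \<open>
  An \<open>m\<close>-linear form on \<open>c0 \<times> \<dots> \<times> c0\<close> is a function \<open>T :: ('m \<Rightarrow> c0) \<Rightarrow> real\<close>, where \<open>'m\<close> is a
  finite type with \<open>m\<close> elements that indexes the factors.  The topology on \<open>'m \<Rightarrow> c0\<close> is the
  product topology, so that continuity of \<open>T\<close> is joint continuity.
\<close>

definition multilinear :: "(('m \<Rightarrow> 'a :: real_vector) \<Rightarrow> real) \<Rightarrow> bool" where
  "multilinear T \<longleftrightarrow> (\<forall>i x. linear (\<lambda>y. T (x(i := y))))"

definition continuous_multilinear_form :: "(('m :: finite \<Rightarrow> c0) \<Rightarrow> real) \<Rightarrow> bool" where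
  "continuous_multilinear_form T \<longleftrightarrow> multilinear T \<and> continuous_on UNIV T"

definition form_norm :: "(('m \<Rightarrow> c0) \<Rightarrow> real) \<Rightarrow> real" where
  "form_norm T = (SUP x \<in> {x. \<forall>i. norm (x i) \<le> 1}. \<bar>T x\<bar>)"

text \<open>
  \<open>T\<close> is a sum of monomials with at most \<open>r\<close> nonzero coefficients; \<open>\<alpha> i\<close> is the coefficient of the
  monomial with multi-index \<open>i\<close>.  Finiteness has to be required separately because the cardinality
  of an infinite set is 0.
\<close>

definition at_most_monomials :: "real \<Rightarrow> (('m :: finite \<Rightarrow> c0) \<Rightarrow> real) \<Rightarrow> bool" where
  "at_most_monomials r T \<longleftrightarrow>
     (\<exists>\<alpha> :: ('m \<Rightarrow> nat) \<Rightarrow> real.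
        finite {i. \<alpha> i \<noteq> 0} \<and> real (card {i. \<alpha> i \<noteq> 0}) \<le> r \<and>
        (\<forall>x. T x = (\<Sum>i | \<alpha> i \<noteq> 0. \<alpha> i * (\<Prod>k\<in>UNIV. c0_nth (x k) (i k)))))"


section \<open>The Bohnenblust--Hille inequality\<close>

text \<open>The summability conjunct says that the left-hand side is finite; \<open>infsum\<close> would otherwise be 0.\<close>

definition bohnenblust_hille :: "real \<Rightarrow> (('m :: finite \<Rightarrow> c0) \<Rightarrow> real) \<Rightarrow> bool" where
  "bohnenblust_hille B T \<longleftrightarrow>
     (let m = real CARD('m);
          a = (\<lambda>j :: 'm \<Rightarrow> nat. \<bar>T (\<lambda>k. c0_basis (j k))\<bar> powr (2 * m / (m + 1)))
      in a summable_on UNIV \<and>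
         (\<Sum>\<^sub>\<infinity>j. a j) powr ((m + 1) / (2 * m)) \<le> B * form_norm T)"

definition optimal_bh_constant :: "(('m :: finite \<Rightarrow> c0) \<Rightarrow> real) set \<Rightarrow> real" where
  "optimal_bh_constant F = Inf {B. 0 \<le> B \<and> (\<forall>T\<in>F. bohnenblust_hille B T)}"

end

theory Submission
  imports Defs
begin

text \<open>
  If \<open>T\<close> has finitely many monomials, then the \<open>\<ell>\<^sup>2\<close> norm of its coefficients is at most
  \<open>\<parallel>T\<parallel>\<close>, whatever the number of monomials and the degree.  To see this, evaluate \<open>T\<close> at vectors all of whose relevant coordinates are
  signs: its monomials become pairwise different Walsh characters, which are orthogonal on the
  finite cube of signs, so the mean of \<open>T\<^sup>2\<close> over the cube is the sum of the squared coefficients.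
  All these vectors lie in the unit balls, hence that sum is at most \<open>\<parallel>T\<parallel>\<^sup>2\<close>
  (lemma \<open>sum_coeff_squares_le_form_norm\<close>).

  The number of monomials enters only in the passage from the exponent \<open>2\<close> down to
  \<open>p = 2 m / (m + 1)\<close>.  For \<open>N\<close> terms the comparison of power means costs the factor
  \<open>N\<close> to the power \<open>1/p - 1/2 = 1/(2 m)\<close>, and \<open>N \<le> K ^ m\<close> turns this factor into at most
  \<open>sqrt K\<close>.
\<close>

section \<open>Comparison of power means\<close>

text \<open>Jensen's inequality for the convex function \<open>t \<mapsto> t powr r\<close> with equal weights.\<close>

lemma powr_sum_le_card_powr_sum_powr:
  fixes b :: "'i \<Rightarrow> real"
  assumes "finite S" and "r \<ge> 1" and pos: "\<And>i. i \<in> S \<Longrightarrow> b i > 0"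
  shows "(\<Sum>i\<in>S. b i) powr r \<le> real (card S) powr (r - 1) * (\<Sum>i\<in>S. b i powr r)"
proof (cases "S = {}")
  case True
  then show ?thesis by simp
next
  case False
  define N where "N = real (card S)"
  have N: "N > 0"
    using False \<open>finite S\<close> by (simp add: N_def card_gt_0_iff)
  have "(\<Sum>i\<in>S. (1 / N) *\<^sub>R b i) powr r \<le> (\<Sum>i\<in>S. (1 / N) * b i powr r)"
    using \<open>finite S\<close> False powr_convex[OF \<open>r \<ge> 1\<close>]
    by (rule convex_on_sum[where f = "\<lambda>t. t powr r"]) (use N pos in \<open>auto simp: N_def\<close>)
  then have "((\<Sum>i\<in>S. b i) / N) powr r \<le> (\<Sum>i\<in>S. b i powr r) / N"
    by (simp add: sum_divide_distrib)
  then have "(\<Sum>i\<in>S. b i) powr r / N powr r \<le> (\<Sum>i\<in>S. b i powr r) / N"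
    using N pos by (simp add: powr_divide sum_nonneg less_imp_le)
  then show ?thesis
    using N by (simp add: powr_diff field_simps flip: N_def)
qed

section \<open>Orthogonality of Walsh characters\<close>

text \<open>
  Walsh characters of the cube \<open>{-1, 1}\<^sup>P\<close> are orthogonal.  The sum factors over the coordinates;
  a coordinate in exactly one of \<open>A\<close> and \<open>B\<close> contributes \<open>-1 + 1 = 0\<close>, any other one \<open>2\<close>.
\<close>

lemma walsh_orthogonality:
  fixes A B P :: "'p set"
  assumes "finite P" and "A \<subseteq> P" and "B \<subseteq> P"
  shows "(\<Sum>s\<in>P \<rightarrow>\<^sub>E {-1, 1::real}. (\<Prod>p\<in>A. s p) * (\<Prod>p\<in>B. s p))
           = (if A = B then 2 ^ card P else 0)"
proof -
  define f :: "'p \<Rightarrow> real \<Rightarrow> real"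
    where "f p t = (if p \<in> A then t else 1) * (if p \<in> B then t else 1)" for p t
  have restrict: "(\<Prod>p\<in>C. s p) = (\<Prod>p\<in>P. if p \<in> C then s p else 1)"
    if "C \<subseteq> P" for C and s :: "'p \<Rightarrow> real"
    using that \<open>finite P\<close> by (simp add: prod.If_cases Int_absorb1)
  have "(\<Sum>s\<in>P \<rightarrow>\<^sub>E {-1, 1::real}. (\<Prod>p\<in>A. s p) * (\<Prod>p\<in>B. s p))
          = (\<Sum>s\<in>P \<rightarrow>\<^sub>E {-1, 1::real}. \<Prod>p\<in>P. f p (s p))"
    by (simp add: restrict[OF \<open>A \<subseteq> P\<close>] restrict[OF \<open>B \<subseteq> P\<close>] f_def prod.distrib)
  also have "\<dots> = (\<Prod>p\<in>P. \<Sum>t\<in>{-1, 1}. f p t)"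
    by (rule prod_sum_PiE[symmetric]) (use \<open>finite P\<close> in auto)
  also have "\<dots> = (\<Prod>p\<in>P. if p \<in> A \<longleftrightarrow> p \<in> B then 2 else 0)"
    by (rule prod.cong) (auto simp: f_def)
  also have "\<dots> = (if A = B then 2 ^ card P else 0)"
  proof (cases "A = B")
    case False
    then have "\<exists>p\<in>P. \<not> (p \<in> A \<longleftrightarrow> p \<in> B)"
      using assms by blast
    then show ?thesis
      using False \<open>finite P\<close> by (subst prod_zero) auto
  qed simp
  finally show ?thesis .
qed

lemma walsh_parseval:
  fixes a :: "'i \<Rightarrow> real" and C :: "'i \<Rightarrow> 'p set"
  assumes "finite P" and "finite S" and inj: "inj_on C S" and sub: "\<And>i. i \<in> S \<Longrightarrow> C i \<subseteq> P"
  shows "(\<Sum>s\<in>P \<rightarrow>\<^sub>E {-1, 1}. (\<Sum>i\<in>S. a i * (\<Prod>p\<in>C i. s p))\<^sup>2) = 2 ^ card P * (\<Sum>i\<in>S. (a i)\<^sup>2)"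
proof -
  let ?w = "\<lambda>i s. \<Prod>p\<in>C i. s p :: real"
  have "(\<Sum>s\<in>P \<rightarrow>\<^sub>E {-1, 1}. (\<Sum>i\<in>S. a i * ?w i s)\<^sup>2)
          = (\<Sum>s\<in>P \<rightarrow>\<^sub>E {-1, 1}. \<Sum>i\<in>S. \<Sum>j\<in>S. a i * a j * (?w i s * ?w j s))"
    by (simp add: power2_eq_square sum_product mult_ac)
  also have "\<dots> = (\<Sum>i\<in>S. \<Sum>s\<in>P \<rightarrow>\<^sub>E {-1, 1}. \<Sum>j\<in>S. a i * a j * (?w i s * ?w j s))"
    by (rule sum.swap)
  also have "\<dots> = (\<Sum>i\<in>S. \<Sum>j\<in>S. \<Sum>s\<in>P \<rightarrow>\<^sub>E {-1, 1}. a i * a j * (?w i s * ?w j s))"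
    by (intro sum.cong refl sum.swap)
  also have "\<dots> = (\<Sum>i\<in>S. \<Sum>j\<in>S. a i * a j * (\<Sum>s\<in>P \<rightarrow>\<^sub>E {-1, 1}. ?w i s * ?w j s))"
    by (simp add: sum_distrib_left)
  also have "\<dots> = (\<Sum>i\<in>S. \<Sum>j\<in>S. if i = j then a i * a j * 2 ^ card P else 0)"
    using inj by (intro sum.cong refl)
      (auto simp: walsh_orthogonality[OF \<open>finite P\<close> sub sub] dest: inj_onD)
  also have "\<dots> = 2 ^ card P * (\<Sum>i\<in>S. (a i)\<^sup>2)"
    using \<open>finite S\<close> by (simp add: sum_distrib_left power2_eq_square mult_ac)
  finally show ?thesis .
qed

text \<open>Some value of a function on the cube is at least its mean, which Parseval's identity gives.\<close>

lemma ex_signs_sum_squares_le: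
  fixes a :: "'i \<Rightarrow> real" and C :: "'i \<Rightarrow> 'p set"
  assumes "finite P" and "finite S" and "inj_on C S" and "\<And>i. i \<in> S \<Longrightarrow> C i \<subseteq> P"
  obtains s where "s \<in> P \<rightarrow>\<^sub>E {-1, 1}" and "(\<Sum>i\<in>S. (a i)\<^sup>2) \<le> (\<Sum>i\<in>S. a i * (\<Prod>p\<in>C i. s p))\<^sup>2"
proof -
  let ?Q = "P \<rightarrow>\<^sub>E {-1, 1::real}" and ?F = "\<lambda>s. (\<Sum>i\<in>S. a i * (\<Prod>p\<in>C i. s p))\<^sup>2"
  have card: "card ?Q = 2 ^ card P"
    using \<open>finite P\<close> by (simp add: card_PiE numeral_2_eq_2)
  have fin: "finite ?Q"
    using \<open>finite P\<close> by (simp add: finite_PiE)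
  have ne: "?Q \<noteq> {}"
    by (simp add: PiE_eq_empty_iff)
  have "\<exists>s\<in>?Q. (\<Sum>i\<in>S. (a i)\<^sup>2) \<le> ?F s"
  proof (rule ccontr)
    assume "\<not> ?thesis"
    then have "(\<Sum>s\<in>?Q. ?F s) < (\<Sum>s\<in>?Q. \<Sum>i\<in>S. (a i)\<^sup>2)"
      using fin ne by (intro sum_strict_mono) auto
    then show False
      using walsh_parseval[OF assms, of a] by (simp add: card)
  qed
  then show ?thesis
    using that by blast
qed

section \<open>Forms with finitely many monomials\<close>

lemma c0_nth_basis: "c0_nth (c0_basis j) n = (if n = j then 1 else 0)"
  by (simp add: c0_basis.rep_eq)

text \<open>
  \<open>form_norm\<close> is a supremum of reals, so boundedness on the product of the unit balls has to be
  known before a value of \<open>T\<close> can be compared with it.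
\<close>

lemma polynomial_form_bdd_above:
  fixes T :: "('m::finite \<Rightarrow> c0) \<Rightarrow> real"
  assumes T: "\<And>x. T x = (\<Sum>i\<in>S. \<alpha> i * (\<Prod>k\<in>UNIV. c0_nth (x k) (i k)))"
  shows "bdd_above ((\<lambda>x. \<bar>T x\<bar>) ` {x. \<forall>k. norm (x k) \<le> 1})"
proof (rule bdd_aboveI2)
  fix x :: "'m \<Rightarrow> c0"
  assume "x \<in> {x. \<forall>k. norm (x k) \<le> 1}"
  then have "\<bar>c0_nth (x k) n\<bar> \<le> 1" for k n
    by (intro order_trans[OF c0_abs_nth_le_norm]) simp
  then have "\<bar>\<Prod>k\<in>UNIV. c0_nth (x k) (i k)\<bar> \<le> 1" for i
    by (simp add: abs_prod prod_le_1)
  then have "\<bar>\<alpha> i * (\<Prod>k\<in>UNIV. c0_nth (x k) (i k))\<bar> \<le> \<bar>\<alpha> i\<bar>" for i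
    by (simp add: abs_mult mult_left_le)
  then show "\<bar>T x\<bar> \<le> (\<Sum>i\<in>S. \<bar>\<alpha> i\<bar>)"
    unfolding T by (intro order_trans[OF sum_abs] sum_mono)
qed

text \<open>
  A multi-index \<open>i\<close> is encoded by its graph in \<open>'m \<times> nat\<close>, so that the monomials become Walsh
  characters in independent signs, one for each pair of a factor and a coordinate.
\<close>

lemma sum_coeff_squares_le_form_norm:
  fixes T :: "('m::finite \<Rightarrow> c0) \<Rightarrow> real"
  assumes "finite S" and T: "\<And>x. T x = (\<Sum>i\<in>S. \<alpha> i * (\<Prod>k\<in>UNIV. c0_nth (x k) (i k)))"
  shows "sqrt (\<Sum>i\<in>S. (\<alpha> i)\<^sup>2) \<le> form_norm T"
proof -
  define C :: "('m \<Rightarrow> nat) \<Rightarrow> ('m \<times> nat) set" where "C i = range (\<lambda>k. (k, i k))" for i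
  define P where "P = (\<Union>i\<in>S. C i)"
  have "finite P"
    using \<open>finite S\<close> by (simp add: P_def C_def)
  have "inj C"
    by (rule injI) (auto simp: C_def fun_eq_iff)
  then obtain s where s: "s \<in> P \<rightarrow>\<^sub>E {-1, 1::real}"
    and le: "(\<Sum>i\<in>S. (\<alpha> i)\<^sup>2) \<le> (\<Sum>i\<in>S. \<alpha> i * (\<Prod>p\<in>C i. s p))\<^sup>2"
    using ex_signs_sum_squares_le[OF \<open>finite P\<close> \<open>finite S\<close>, of C \<alpha>] inj_on_subset
    unfolding P_def by blast
  \<comment> \<open>Continuing the signs by 0 outside the finite set \<open>P\<close> makes them null sequences.\<close>
  define v where "v k n = (if (k, n) \<in> P then s (k, n) else 0)" for k n
  have "v k \<longlonglongrightarrow> 0" for k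
  proof (rule tendsto_eventually)
    have "{n. v k n \<noteq> 0} \<subseteq> snd ` P"
      by (auto simp: v_def intro: rev_image_eqI split: if_splits)
    then have "finite {n. v k n \<noteq> 0}"
      using \<open>finite P\<close> finite_surj by blast
    then show "\<forall>\<^sub>F n in sequentially. v k n = 0"
      by (simp add: cofinite_eq_sequentially[symmetric] eventually_cofinite)
  qed
  then have nth: "c0_nth (Abs_c0 (v k)) = v k" for k
    by (simp add: Abs_c0_inverse)
  let ?x = "\<lambda>k. Abs_c0 (v k)"
  have "\<bar>v k n\<bar> \<le> 1" for k n
    using s by (auto simp: v_def dest: PiE_mem)
  then have "norm (?x k) \<le> 1" for k
    by (intro c0_norm_leI) (simp add: nth)
  then have bound: "\<bar>T ?x\<bar> \<le> form_norm T"
    unfolding form_norm_def by (intro cSUP_upper polynomial_form_bdd_above[OF T]) auto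
  have "(\<Prod>k\<in>UNIV. v k (i k)) = (\<Prod>p\<in>C i. s p)" if "i \<in> S" for i
  proof -
    have "(\<Prod>p\<in>C i. s p) = (\<Prod>k\<in>UNIV. s (k, i k))"
      unfolding C_def by (subst prod.reindex) (auto simp: inj_on_def)
    moreover have "v k (i k) = s (k, i k)" for k
      using that by (auto simp: v_def P_def C_def)
    ultimately show ?thesis by simp
  qed
  then have "T ?x = (\<Sum>i\<in>S. \<alpha> i * (\<Prod>p\<in>C i. s p))"
    by (simp add: T nth)
  then have "sqrt (\<Sum>i\<in>S. (\<alpha> i)\<^sup>2) \<le> \<bar>T ?x\<bar>"
    using real_sqrt_le_mono[OF le] by simp
  then show ?thesis
    using bound by linarith
qed

text \<open>
  With \<open>b j = \<bar>\<alpha> j\<bar> powr p\<close> and \<open>r = 2 / p = (m + 1) / m\<close>, the comparison of power means reads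
  \<open>(\<Sum>j. \<bar>\<alpha> j\<bar> powr p) powr (2 / p) \<le> N powr (1 / m) * (\<Sum>j. (\<alpha> j)\<^sup>2)\<close>, where \<open>N powr (1 / m) \<le> K\<close>;
  its square root is the inequality.
\<close>

lemma bohnenblust_hille_few_monomials:
  fixes T :: "('m::finite \<Rightarrow> c0) \<Rightarrow> real"
  assumes "K \<ge> 0" and "at_most_monomials (K ^ CARD('m)) T"
  shows "bohnenblust_hille (sqrt K) T"
proof -
  obtain \<alpha> where fin: "finite {i. \<alpha> i \<noteq> 0}"
    and card: "real (card {i. \<alpha> i \<noteq> 0}) \<le> K ^ CARD('m)"
    and T: "\<And>x. T x = (\<Sum>i | \<alpha> i \<noteq> 0. \<alpha> i * (\<Prod>k\<in>UNIV. c0_nth (x k) (i k)))"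
    using assms(2) unfolding at_most_monomials_def by blast
  define S where "S = {i. \<alpha> i \<noteq> 0}"
  define m where "m = real CARD('m)"
  define p where "p = 2 * m / (m + 1)"
  define a where "a j = \<bar>T (\<lambda>k. c0_basis (j k))\<bar> powr p" for j :: "'m \<Rightarrow> nat"
  have m: "m > 0"
    by (simp add: m_def card_gt_0_iff)
  have "T (\<lambda>k. c0_basis (j k)) = \<alpha> j" for j
  proof -
    have "(\<Prod>k\<in>UNIV. c0_nth (c0_basis (j k)) (i k)) = (if i = j then 1 else 0)" for i
    proof (cases "i = j")
      case False
      then obtain k where "i k \<noteq> j k" by blast
      then show ?thesis
        using False by (auto simp: c0_nth_basis intro!: prod_zero)
    qed (simp add: c0_nth_basis)
    then show ?thesis
      using fin by (simp add: T if_distrib[of "times _"] cong: if_cong)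
  qed
  then have a: "a j = \<bar>\<alpha> j\<bar> powr p" for j
    by (simp add: a_def)
  have zero: "a j = 0" if "j \<notin> S" for j
    using that by (simp add: a S_def)
  have "finite S"
    using fin by (simp add: S_def)
  then have "(a has_sum (\<Sum>j\<in>S. a j)) UNIV"
    by (rule has_sum_finite_neutralI) (use zero in auto)
  then have summable: "a summable_on UNIV" and sum: "(\<Sum>\<^sub>\<infinity>j. a j) = (\<Sum>j\<in>S. a j)"
    by (auto simp: summable_on_def infsumI)
  define r where "r = (m + 1) / m"
  have r: "r \<ge> 1" "r - 1 = 1 / m" "(m + 1) / (2 * m) = r * (1 / 2)"
    using m by (simp_all add: r_def field_simps)
  have "m + 1 \<noteq> 0"
    using m by simp
  then have pr: "p * r = 2"
    using m by (simp add: r_def p_def)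
  have "(\<Sum>j\<in>S. a j) powr r \<le> real (card S) powr (1 / m) * (\<Sum>j\<in>S. a j powr r)"
    using powr_sum_le_card_powr_sum_powr[of S r a] fin r by (simp add: S_def a)
  also have "(\<Sum>j\<in>S. a j powr r) = (\<Sum>j\<in>S. (\<alpha> j)\<^sup>2)"
    by (rule sum.cong) (auto simp: a powr_powr pr S_def)
  also have "real (card S) powr (1 / m) * \<dots> \<le> K * \<dots>"
  proof (rule mult_right_mono)
    have "real (card S) powr (1 / m) \<le> (K ^ CARD('m)) powr (1 / m)"
      using card m by (intro powr_mono2) (auto simp: S_def)
    also have "\<dots> = K"
      using \<open>K \<ge> 0\<close> m by (cases "K = 0") (simp_all add: m_def powr_powr flip: powr_realpow)
    finally show "real (card S) powr (1 / m) \<le> K" .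
  qed (simp add: sum_nonneg)
  finally have le: "(\<Sum>j\<in>S. a j) powr r \<le> K * (\<Sum>j\<in>S. (\<alpha> j)\<^sup>2)" .
  have "(\<Sum>\<^sub>\<infinity>j. a j) powr ((m + 1) / (2 * m)) = sqrt ((\<Sum>j\<in>S. a j) powr r)"
    unfolding sum r(3) powr_powr[symmetric] by (simp add: powr_half_sqrt)
  also have "\<dots> \<le> sqrt (K * (\<Sum>j\<in>S. (\<alpha> j)\<^sup>2))"
    using le by simp
  also have "\<dots> \<le> sqrt K * form_norm T"
    using sum_coeff_squares_le_form_norm[OF fin T] \<open>K \<ge> 0\<close>
    by (simp add: real_sqrt_mult mult_left_mono S_def)
  finally show ?thesis
    using summable
    by (simp add: bohnenblust_hille_def Let_def a_def[abs_def] m_def[symmetric] p_def)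
qed

lemma optimal_bh_constant_le:
  assumes "B \<ge> 0" and "\<And>T. T \<in> F \<Longrightarrow> bohnenblust_hille B T"
  shows "optimal_bh_constant F \<le> B"
  unfolding optimal_bh_constant_def
  by (rule cInf_lower) (use assms in \<open>auto intro: bdd_belowI[of _ 0]\<close>)

theorem corollary5p5:
  fixes m :: nat and K :: real
  assumes "CARD('m :: finite) = m" and "m \<ge> 2" and "K \<ge> 1"
  shows "(\<forall>T :: ('m \<Rightarrow> c0) \<Rightarrow> real.
            continuous_multilinear_form T \<and> at_most_monomials (K ^ m) T \<longrightarrow>
              (\<lambda>j :: 'm \<Rightarrow> nat. \<bar>T (\<lambda>k. c0_basis (j k))\<bar> powr (2 * real m / (real m + 1))) summable_on UNIV \<and>
              (\<Sum>\<^sub>\<infinity>j :: 'm \<Rightarrow> nat. \<bar>T (\<lambda>k. c0_basis (j k))\<bar> powr (2 * real m / (real m + 1)))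
                powr ((real m + 1) / (2 * real m)) \<le> sqrt K * form_norm T) \<and>
         optimal_bh_constant
           {T :: ('m \<Rightarrow> c0) \<Rightarrow> real. continuous_multilinear_form T \<and> at_most_monomials (K ^ m) T} \<le> sqrt K"
proof -
  let ?F = "{T :: ('m \<Rightarrow> c0) \<Rightarrow> real. continuous_multilinear_form T \<and> at_most_monomials (K ^ m) T}"
  have bh: "bohnenblust_hille (sqrt K) T" if "T \<in> ?F" for T
    using bohnenblust_hille_few_monomials[of K T] that assms by simp
  have "optimal_bh_constant ?F \<le> sqrt K"
    using \<open>K \<ge> 1\<close> by (intro optimal_bh_constant_le bh) simp_all
  then show ?thesis
    using bh assms(1) by (simp add: bohnenblust_hille_def Let_def)
qed

end
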